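(* Let $(X,d)$ be a compact metric space and let $\mathcal K(X)$ be the set of all non-empty compact subsets of $X$, equipped with the Hausdorff metric. The function $\Delta_{\mathrm L}:\mathcal K(X)\to\mathbb R$ defined by \[ \Delta_{\mathrm L}(F)=\dim_{\mathrm L}F \] is of Baire class 3 and, in particular, Borel measurable.
   Context: The Hausdorff metric is $d_{\mathcal H}(E,F)=\inf\{\varepsilon>0: E\subseteq F_\varepsilon\text{ and }F\subseteq E_\varepsilon\}$ for $E,F\in\mathcal K(X)$, where $E_\varepsilon$ denotes the $\varepsilon$-neighbourhood of $E$. A function $f:A\to B$ between metric spaces is of Baire class 0 if it is continuous; inductively, it is of Baire class $n+1$ if it is in the pointwise closure of the Baire class $n$ functions. For $r>0$ and a non-empty set $F\subseteq X$, $N_r(F)$ denotes the smallest number of open sets with diameter less than or equal to $r$ required to cover $F$, and $B(x,R)$ is the (closed) ball of centre $x$ and radius $R$. The lower dimension of $F$ (regarded as a metric space in its own right) is \[ \dim_{\mathrm L}F=\sup\Big\{\alpha:\ \text{there exist } C,\rho>0 \text{ such that, for all } 0<r<R\leq\rho,\ \inf_{x\in F}N_r\big(B(x,R)\cap F\big)\geq C \Big(\frac{R}{r}\Big)^{\alpha}\Big\}. \] *)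

theory Defs
  imports "HOL-Analysis.Analysis"
begin

section \<open>The space of non-empty compact subsets\<close>

typedef (overloaded) 'a compacts = "{F :: 'a::metric_space set. compact F \<and> F \<noteq> {}}"
  morphisms carrier_of Compacts
  by (rule exI[of _ "{undefined}"]) simp

definition nbhd :: "real \<Rightarrow> 'a::metric_space set \<Rightarrow> 'a set"
  where "nbhd \<epsilon> E = (\<Union>x\<in>E. ball x \<epsilon>)"

definition hausdorff_radii :: "'a::metric_space set \<Rightarrow> 'a set \<Rightarrow> real set"
  where "hausdorff_radii E F = {\<epsilon>. \<epsilon> > 0 \<and> E \<subseteq> nbhd \<epsilon> F \<and> F \<subseteq> nbhd \<epsilon> E}"

lemma compact_carrier_of: "compact (carrier_of F)"
  and carrier_of_nonempty: "carrier_of F \<noteq> {}"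
  using carrier_of[of F] by auto

lemma hausdorff_radii_commute: "hausdorff_radii E F = hausdorff_radii F E"
  by (auto simp: hausdorff_radii_def)

lemma hausdorff_radii_nonempty:
  assumes "compact E" "E \<noteq> {}" "compact F" "F \<noteq> {}"
  shows "hausdorff_radii E F \<noteq> {}"
proof -
  have "bounded (E \<union> F)" using assms by (simp add: compact_imp_bounded)
  then obtain b where b: "\<And>x y. x \<in> E \<union> F \<Longrightarrow> y \<in> E \<union> F \<Longrightarrow> dist x y \<le> b"
    unfolding bounded_two_points by blast
  have "max b 0 + 1 \<in> hausdorff_radii E F"
  proof -
    have *: "A \<subseteq> nbhd (max b 0 + 1) B" if sub: "A \<subseteq> E \<union> F" "B \<subseteq> E \<union> F" "B \<noteq> {}" for A B
    proof
      fix x assume "x \<in> A"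
      obtain y where y: "y \<in> B" using sub(3) by blast
      have "dist y x \<le> b" using b \<open>x \<in> A\<close> y sub by blast
      then show "x \<in> nbhd (max b 0 + 1) B" using y 
        unfolding nbhd_def by (intro UN_I[OF y]) simp
    qed
    show ?thesis using *[of E F] *[of F E] assms by (auto simp: hausdorff_radii_def)
  qed
  then show ?thesis by blast
qed

lemma hausdorff_radii_bdd_below: "bdd_below (hausdorff_radii E F)"
  by (rule bdd_belowI[of _ 0]) (auto simp: hausdorff_radii_def)

lemma hausdorff_radii_triangle:
  assumes "a \<in> hausdorff_radii E F" "b \<in> hausdorff_radii F G"
  shows "a + b \<in> hausdorff_radii E G"
proof -
  have *: "A \<subseteq> nbhd (s + t) C" if sub: "A \<subseteq> nbhd s B" "B \<subseteq> nbhd t C" for A B C :: "'a set" and s t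
  proof
    fix x assume "x \<in> A"
    then obtain y where y: "y \<in> B" "dist y x < s" using sub(1) by (auto simp: nbhd_def)
    then obtain z where z: "z \<in> C" "dist z y < t" using sub(2) by (auto simp: nbhd_def)
    have "dist z x < s + t" using y z dist_triangle[of z x y] by linarith
    then show "x \<in> nbhd (s + t) C" using z by (auto simp: nbhd_def)
  qed
  show ?thesis
    using assms *[of E a F b G] *[of G b F a E]
    by (simp add: hausdorff_radii_def add.commute[of b a])
qed

lemma subset_of_small_nbhds:
  assumes "closed F" "\<And>e. e > 0 \<Longrightarrow> E \<subseteq> nbhd e F"
  shows "E \<subseteq> F"
proof
  fix x assume "x \<in> E"
  have "x \<in> closure F"
    unfolding closure_approachable
  proof (intro allI impI)
    fix e :: real assume "e > 0"
    then show "\<exists>y\<in>F. dist y x < e" using assms(2) \<open>x \<in> E\<close> by (force simp: nbhd_def)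
  qed
  then show "x \<in> F" using assms(1) by simp
qed

lemma nbhd_mono: "d \<le> e \<Longrightarrow> nbhd d E \<subseteq> nbhd e E"
  by (force simp: nbhd_def)

lemma subset_nbhd: "e > 0 \<Longrightarrow> E \<subseteq> nbhd e E"
  unfolding nbhd_def using centre_in_ball by blast

instantiation compacts :: (metric_space) metric_space
begin

definition dist_compacts :: "'a compacts \<Rightarrow> 'a compacts \<Rightarrow> real" where
  "dist_compacts E F = Inf {\<epsilon>. \<epsilon> > 0 \<and> carrier_of E \<subseteq> nbhd \<epsilon> (carrier_of F) \<and>
                              carrier_of F \<subseteq> nbhd \<epsilon> (carrier_of E)}"

definition uniformity_compacts :: "('a compacts \<times> 'a compacts) filter" where
  "uniformity_compacts = (INF e\<in>{0<..}. principal {(E, F). dist E F < e})"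

definition open_compacts :: "'a compacts set \<Rightarrow> bool" where
  "open_compacts U \<longleftrightarrow>
     (\<forall>E\<in>U. eventually (\<lambda>(E', F). E' = E \<longrightarrow> F \<in> U) uniformity)"

instance
proof
  have d: "dist E F = Inf (hausdorff_radii (carrier_of E) (carrier_of F))" for E F :: "'a compacts"
    by (simp add: dist_compacts_def hausdorff_radii_def)
  have ne: "hausdorff_radii (carrier_of E) (carrier_of F) \<noteq> {}" for E F :: "'a compacts"
    by (intro hausdorff_radii_nonempty compact_carrier_of carrier_of_nonempty)
  have lt: "\<exists>a \<in> hausdorff_radii (carrier_of E) (carrier_of F). a < e" if "dist E F < e"
    for E F :: "'a compacts" and e
    using that cInf_less_iff[OF ne hausdorff_radii_bdd_below] by (simp add: d)
  have le: "dist E F \<le> a" if "a \<in> hausdorff_radii (carrier_of E) (carrier_of F)"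
    for E F :: "'a compacts" and a
    using that by (simp add: d cInf_lower hausdorff_radii_bdd_below)
  show "uniformity = (INF e\<in>{0<..}. principal {(x :: 'a compacts, y). dist x y < e})"
    by (rule uniformity_compacts_def)
  show "open U \<longleftrightarrow> (\<forall>x\<in>U. \<forall>\<^sub>F (x', y) in uniformity. x' = x \<longrightarrow> y \<in> U)"
    for U :: "'a compacts set"
    by (rule open_compacts_def)
  show "dist E F = 0 \<longleftrightarrow> E = F" for E F :: "'a compacts"
  proof
    assume 0: "dist E F = 0"
    have "carrier_of E \<subseteq> nbhd e (carrier_of F) \<and> carrier_of F \<subseteq> nbhd e (carrier_of E)"
      if "e > 0" for e
    proof -
      obtain a where a: "a \<in> hausdorff_radii (carrier_of E) (carrier_of F)" "a < e"
        using lt[of E F e] 0 \<open>e > 0\<close> by auto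
      then show ?thesis
        using nbhd_mono[of a e "carrier_of E"] nbhd_mono[of a e "carrier_of F"]
        by (auto simp: hausdorff_radii_def)
    qed
    then have "carrier_of E \<subseteq> carrier_of F" "carrier_of F \<subseteq> carrier_of E"
      using subset_of_small_nbhds compact_imp_closed[OF compact_carrier_of] by metis+
    then have "carrier_of E = carrier_of F" by (rule equalityI)
    then show "E = F" by (simp add: carrier_of_inject)
  next
    assume "E = F"
    then have "e \<in> hausdorff_radii (carrier_of E) (carrier_of F)" if "e > 0" for e
      using that by (auto simp: hausdorff_radii_def subset_nbhd)
    then have "dist E F \<le> e" if "e > 0" for e
      using that le by blast
    then have "dist E F \<le> 0" by (rule field_le_epsilon) simp
    moreover have "dist E F \<ge> 0"
      unfolding d by (rule cInf_greatest[OF ne]) (simp add: hausdorff_radii_def)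
    ultimately show "dist E F = 0" by simp
  qed
  show "dist E F \<le> dist E G + dist F G" for E F G :: "'a compacts"
  proof (rule field_le_epsilon)
    fix e :: real assume "e > 0"
    obtain a where a: "a \<in> hausdorff_radii (carrier_of E) (carrier_of G)" "a < dist E G + e / 2"
      using lt[of E G] \<open>e > 0\<close> by (metis half_gt_zero less_add_same_cancel1)
    obtain b where b: "b \<in> hausdorff_radii (carrier_of F) (carrier_of G)" "b < dist F G + e / 2"
      using lt[of F G] \<open>e > 0\<close> by (metis half_gt_zero less_add_same_cancel1)
    have "dist E F \<le> a + b"
      using le hausdorff_radii_triangle[OF a(1)] b(1) hausdorff_radii_commute by blast
    then show "dist E F \<le> dist E G + dist F G + e" using a b by linarith
  qed
qed

end

section \<open>Baire classes\<close>

text \<open>The pointwise closure is taken under limits of sequences, as usual for Baire classes: in the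
  product topology the continuous functions are typically already dense.  Only the topologies of
  the domain and the codomain matter, and the codomain is allowed to be \<^typ>\<open>ereal\<close>.\<close>

primrec baire_class :: "nat \<Rightarrow> ('a::topological_space \<Rightarrow> 'b::topological_space) \<Rightarrow> bool" where
  "baire_class 0 f \<longleftrightarrow> continuous_on UNIV f"
| "baire_class (Suc n) f \<longleftrightarrow>
     (\<exists>g. (\<forall>k::nat. baire_class n (g k)) \<and> (\<forall>x. (\<lambda>k. g k x) \<longlonglongrightarrow> f x))"

section \<open>The lower dimension\<close>

text \<open>\<^term>\<open>bounded U\<close> is required because \<^const>\<open>diameter\<close> is unspecified on unbounded sets.
  The value is infinite if there is no finite cover.\<close>

definition covering_number :: "real \<Rightarrow> 'a::metric_space set \<Rightarrow> enat" where
  "covering_number r F =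
     (INF \<U>\<in>{\<U>. finite \<U> \<and> (\<forall>U\<in>\<U>. open U \<and> bounded U \<and> diameter U \<le> r) \<and> F \<subseteq> \<Union>\<U>}.
        enat (card \<U>))"

text \<open>The supremum is taken in \<^typ>\<open>ereal\<close>, since a compact metric space may have infinite
  lower dimension.\<close>

definition lower_dim :: "'a::metric_space set \<Rightarrow> ereal" where
  "lower_dim F = Sup (ereal ` {\<alpha>. \<exists>C>0. \<exists>\<rho>>0. \<forall>r R. 0 < r \<and> r < R \<and> R \<le> \<rho> \<longrightarrow>
     ereal_of_enat (INF x\<in>F. covering_number r (cball x R \<inter> F)) \<ge> ereal (C * (R / r) powr \<alpha>)})"

definition Delta_L :: "'a::metric_space compacts \<Rightarrow> ereal" where
  "Delta_L F = lower_dim (carrier_of F)"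

end

theory Submission
  imports Defs
begin

text \<open>
  Fix an exponent \<open>\<alpha>\<close>, a constant \<open>C\<close> and a threshold \<open>\<rho>\<close>.  That a compact set \<open>F\<close> violates the
  scaling bound \<open>N\<^sub>r(B(x, R) \<inter> F) \<ge> C (R / r)\<^sup>\<alpha>\<close> for some \<open>x \<in> F\<close> and some \<open>r < R \<le> \<rho>\<close> is witnessed
  by a single finite cover of \<open>B(x, R) \<inter> F\<close> that has too few members.  The members of the cover are
  open while \<open>B(x, R) \<inter> F\<close> is compact, so the same cover still works after a small perturbation of
  both \<open>x\<close> and \<open>F\<close>.  Hence violation is an open condition, and the sets that satisfy the bound for
  all \<open>r < R \<le> \<rho>\<close> form a closed subset of the hyperspace (\<open>closed_uniformly_thick\<close>).

  The bound is monotone in each of \<open>\<alpha>\<close>, \<open>C\<close> and \<open>\<rho>\<close>, so countably many parameter values suffice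
  to compute the lower dimension: it is the supremum of countably many step functions, each taking
  some value \<open>\<alpha> \<ge> 0\<close> on one of these closed sets and \<open>0\<close> elsewhere (\<open>Delta_L_eq_SUP_step\<close>).  A
  step function of this kind is a limit of continuous functions, and so is a maximum of finitely
  many of them.  The supremum is the limit of these maxima, so the lower dimension is already of
  Baire class 2, and therefore of Baire class 3.  The finite maxima are real-valued; this is why the
  argument also serves the real-valued version of the function when the lower dimension is finite.
\<close>

section \<open>Baire classes\<close>

lemma baire_class_SucI:
  "(\<And>k. baire_class n (g k)) \<Longrightarrow> (\<And>x. (\<lambda>k. g k x) \<longlonglongrightarrow> f x) \<Longrightarrow> baire_class (Suc n) f"
  by auto

lemma baire_class_Suc_mono:
  assumes "baire_class n f"
  shows "baire_class (Suc n) f"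
  by (rule baire_class_SucI[where g = "\<lambda>_. f"]) (use assms in auto)

lemma baire_class_continuous_compose:
  fixes f :: "'a::topological_space \<Rightarrow> 'b::t2_space" and \<phi> :: "'b \<Rightarrow> 'c::topological_space"
  assumes "continuous_on UNIV \<phi>" "baire_class n f"
  shows "baire_class n (\<lambda>x. \<phi> (f x))"
  using assms(2)
proof (induction n arbitrary: f)
  case 0
  then show ?case using continuous_on_compose2[OF assms(1)] by simp
next
  case (Suc n)
  then obtain g where g: "\<And>k. baire_class n (g k)" "\<And>x. (\<lambda>k. g k x) \<longlonglongrightarrow> f x"
    by auto
  show ?case
  proof (rule baire_class_SucI[where g = "\<lambda>k x. \<phi> (g k x)"])
    show "baire_class n (\<lambda>x. \<phi> (g k x))" for k
      using g(1) by (rule Suc.IH)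
    have "isCont \<phi> y" for y
      using assms(1) by (simp add: continuous_on_eq_continuous_at)
    then show "(\<lambda>k. \<phi> (g k x)) \<longlonglongrightarrow> \<phi> (f x)" for x
      using g(2) by (rule isCont_tendsto_compose)
  qed
qed

lemma baire_class_max:
  fixes f g :: "'a::topological_space \<Rightarrow> 'b::linorder_topology"
  assumes "baire_class n f" "baire_class n g"
  shows "baire_class n (\<lambda>x. max (f x) (g x))"
  using assms
proof (induction n arbitrary: f g)
  case 0
  then show ?case by (simp add: continuous_on_max)
next
  case (Suc n)
  then obtain u v where
    "\<And>k. baire_class n (u k)" "\<And>x. (\<lambda>k. u k x) \<longlonglongrightarrow> f x"
    "\<And>k. baire_class n (v k)" "\<And>x. (\<lambda>k. v k x) \<longlonglongrightarrow> g x"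
    by auto
  then show ?case
    by (intro baire_class_SucI[where g = "\<lambda>k x. max (u k x) (v k x)"] Suc.IH tendsto_max)
qed

lemma baire_class_Max:
  fixes h :: "nat \<Rightarrow> 'a::topological_space \<Rightarrow> 'b::linorder_topology"
  assumes "\<And>i. baire_class n (h i)"
  shows "baire_class n (\<lambda>x. Max ((\<lambda>i. h i x) ` {..m}))"
proof (induction m)
  case 0
  then show ?case using assms by simp
next
  case (Suc m)
  have "Max ((\<lambda>i. h i x) ` {..Suc m}) = max (h (Suc m) x) (Max ((\<lambda>i. h i x) ` {..m}))" for x
    by (simp add: atMost_Suc)
  then show ?case using baire_class_max[OF assms Suc] by simp
qed

lemma baire_class_imp_borel_measurable:
  fixes f :: "'a::topological_space \<Rightarrow>
    'b::{complete_linorder, second_countable_topology, linorder_topology}"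
  assumes "baire_class n f"
  shows "f \<in> borel_measurable borel"
  using assms
proof (induction n arbitrary: f)
  case 0
  then show ?case by (simp add: borel_measurable_continuous_onI)
next
  case (Suc n)
  then show ?case by (auto intro: borel_measurable_LIMSEQ_order)
qed

text \<open>The approximants are tents of height \<open>c\<close> over \<open>A\<close> whose slopes steepen; off \<open>A\<close> they vanish
  eventually because the distance to the closed set \<open>A\<close> is positive there.\<close>

lemma baire_class_1_step_closed:
  fixes A :: "'a::metric_space set" and c :: real
  assumes "closed A"
  shows "baire_class 1 (\<lambda>x. if x \<in> A then c else 0)"
proof (cases "A = {}")
  case True
  then show ?thesis using baire_class_Suc_mono[of 0 "\<lambda>_::'a. 0::real"] by simp
next
  case False
  let ?g = "\<lambda>k x. c * max 0 (1 - real k * infdist x A)"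
  have "baire_class (Suc 0) (\<lambda>x. if x \<in> A then c else 0)"
  proof (rule baire_class_SucI[where g = ?g])
    show "baire_class 0 (?g k)" for k
      by (auto intro!: continuous_intros)
    show "(\<lambda>k. ?g k x) \<longlonglongrightarrow> (if x \<in> A then c else 0)" for x
    proof (cases "x \<in> A")
      case True
      then show ?thesis by simp
    next
      case xA: False
      have pos: "0 < infdist x A"
        using infdist_pos_not_in_closed[OF assms False xA] .
      then obtain N :: nat where N: "1 < real N * infdist x A"
        using reals_Archimedean3 by blast
      have "?g k x = 0" if "N \<le> k" for k
      proof -
        have "real N * infdist x A \<le> real k * infdist x A"
          using that pos by (intro mult_right_mono) auto
        then show ?thesis using N by simp
      qed
      then have "\<forall>\<^sub>F k in sequentially. ?g k x = 0"
        unfolding eventually_sequentially by blast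
      then show ?thesis using xA by (simp add: tendsto_eventually)
    qed
  qed
  then show ?thesis by simp
qed

lemma Max_prefix_tendsto_SUP:
  fixes h :: "nat \<Rightarrow> 'a::{complete_linorder, linorder_topology}"
  shows "(\<lambda>m. Max (h ` {..m})) \<longlonglongrightarrow> (SUP i. h i)"
proof -
  have "incseq (\<lambda>m. Max (h ` {..m}))"
    by (intro incseq_SucI Max_mono) auto
  then have "(\<lambda>m. Max (h ` {..m})) \<longlonglongrightarrow> (SUP m. Max (h ` {..m}))"
    by (rule LIMSEQ_SUP)
  moreover have "(SUP m. Max (h ` {..m})) = (SUP i. h i)"
  proof (rule antisym)
    show "(SUP m. Max (h ` {..m})) \<le> (SUP i. h i)"
      by (intro SUP_least Max.boundedI) (auto intro: SUP_upper)
    show "(SUP i. h i) \<le> (SUP m. Max (h ` {..m}))"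
      by (intro SUP_mono) (auto intro!: Max_ge)
  qed
  ultimately show ?thesis by simp
qed

section \<open>Covering numbers\<close>

text \<open>By well-ordering the infimum of a non-empty set is one of its members, so no limit has to be
  exchanged with the embedding into \<^typ>\<open>ereal\<close>.\<close>

lemma le_ereal_of_enat_Inf_iff:
  "c \<le> ereal_of_enat (Inf N) \<longleftrightarrow> (\<forall>n\<in>N. c \<le> ereal_of_enat n)"
proof (cases "N = {}")
  case True
  then show ?thesis by (simp add: top_enat_def)
next
  case False
  then have "Inf N \<in> N"
    unfolding Inf_enat_def by (auto intro: LeastI)
  then show ?thesis
    using Inf_lower[of _ N] by (meson ereal_of_enat_le_iff order_trans)
qed

definition open_cover_of_mesh :: "real \<Rightarrow> 'a::metric_space set \<Rightarrow> 'a set set \<Rightarrow> bool" where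
  "open_cover_of_mesh r F \<U> \<longleftrightarrow>
     finite \<U> \<and> (\<forall>U\<in>\<U>. open U \<and> bounded U \<and> diameter U \<le> r) \<and> F \<subseteq> \<Union>\<U>"

lemma le_covering_number_iff:
  "ereal c \<le> ereal_of_enat (covering_number r F) \<longleftrightarrow>
     (\<forall>\<U>. open_cover_of_mesh r F \<U> \<longrightarrow> c \<le> real (card \<U>))"
  unfolding covering_number_def le_ereal_of_enat_Inf_iff open_cover_of_mesh_def by auto

lemma le_INF_covering_number_iff:
  "ereal c \<le> ereal_of_enat (INF x\<in>I. covering_number r (B x)) \<longleftrightarrow>
     (\<forall>x\<in>I. \<forall>\<U>. open_cover_of_mesh r (B x) \<U> \<longrightarrow> c \<le> real (card \<U>))"
  unfolding le_ereal_of_enat_Inf_iff by (simp add: le_covering_number_iff)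

section \<open>Sets that are thick with given constants\<close>

text \<open>This is the scaling condition in the definition of the lower dimension.  It is phrased with
  individual covers instead of covering numbers, so that its failure comes with one cover as a
  witness.\<close>

definition uniformly_thick :: "real \<Rightarrow> real \<Rightarrow> real \<Rightarrow> 'a::metric_space set \<Rightarrow> bool" where
  "uniformly_thick \<alpha> C \<rho> F \<longleftrightarrow> (\<forall>r R. 0 < r \<and> r < R \<and> R \<le> \<rho> \<longrightarrow>
     (\<forall>x\<in>F. \<forall>\<U>. open_cover_of_mesh r (cball x R \<inter> F) \<U> \<longrightarrow> C * (R / r) powr \<alpha> \<le> real (card \<U>)))"

lemma lower_dim_eq_Sup_uniformly_thick:
  "lower_dim F = Sup (ereal ` {\<alpha>. \<exists>C>0. \<exists>\<rho>>0. uniformly_thick \<alpha> C \<rho> F})"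
  unfolding lower_dim_def uniformly_thick_def le_INF_covering_number_iff ..

lemma uniformly_thick_mono:
  assumes "uniformly_thick \<alpha> C \<rho> F" "\<beta> \<le> \<alpha>" "D \<le> C" "0 \<le> C" "\<sigma> \<le> \<rho>"
  shows "uniformly_thick \<beta> D \<sigma> F"
  unfolding uniformly_thick_def
proof (intro allI impI ballI)
  fix r R x \<U>
  assume r: "0 < r \<and> r < R \<and> R \<le> \<sigma>" and x: "x \<in> F" "open_cover_of_mesh r (cball x R \<inter> F) \<U>"
  have "D * (R / r) powr \<beta> \<le> C * (R / r) powr \<alpha>"
    using assms r by (intro mult_mono powr_mono) (auto simp: field_simps)
  also have "\<dots> \<le> real (card \<U>)"
    using assms(1,5) r x unfolding uniformly_thick_def by force
  finally show "D * (R / r) powr \<beta> \<le> real (card \<U>)" .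
qed

text \<open>A cover of a ball around a point of \<open>F\<close> has at least one member, so the exponent \<open>0\<close> is always
  admissible and the lower dimension is non-negative.\<close>

lemma uniformly_thick_0: "uniformly_thick 0 1 \<rho> F"
  unfolding uniformly_thick_def
proof (intro allI impI ballI)
  fix r R x \<U>
  assume r: "0 < r \<and> r < R \<and> R \<le> \<rho>" and x: "x \<in> F" "open_cover_of_mesh r (cball x R \<inter> F) \<U>"
  have "x \<in> cball x R \<inter> F" using r x by simp
  moreover have "cball x R \<inter> F \<subseteq> \<Union>\<U>" "finite \<U>"
    using x(2) unfolding open_cover_of_mesh_def by auto
  ultimately have "\<U> \<noteq> {}" by blast
  then have "1 \<le> card \<U>" using \<open>finite \<U>\<close> by (simp add: Suc_leI card_gt_0_iff)
  then show "1 * (R / r) powr 0 \<le> real (card \<U>)" using r by simp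
qed

section \<open>Thickness is a closed condition\<close>

lemma dist_compacts_less_imp_near:
  assumes "dist E F < e" "x \<in> carrier_of E"
  obtains y where "y \<in> carrier_of F" "dist x y < e"
proof -
  have "Inf (hausdorff_radii (carrier_of E) (carrier_of F)) < e"
    using assms(1) by (simp add: dist_compacts_def hausdorff_radii_def)
  then obtain a where "a < e" "a \<in> hausdorff_radii (carrier_of E) (carrier_of F)"
    using cInf_less_iff[OF hausdorff_radii_nonempty hausdorff_radii_bdd_below]
      compact_carrier_of carrier_of_nonempty by metis
  then obtain y where "y \<in> carrier_of F" "dist y x < a"
    using assms(2) unfolding hausdorff_radii_def nbhd_def by auto
  then show ?thesis using \<open>a < e\<close> that by (auto simp: dist_commute)
qed

text \<open>The radius is enlarged as well, because in the application the centre of the ball moves too.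
  If no \<open>e\<close> works, there are points outside \<open>V\<close> that approach both \<open>F\<close> and the ball; by compactness of
  \<open>F\<close> they accumulate at a point of \<open>cball x R \<inter> F\<close> outside \<open>V\<close>.\<close>

lemma compact_ball_section_thickening:
  fixes F V :: "'a::metric_space set"
  assumes "compact F" "open V" "cball x R \<inter> F \<subseteq> V"
  obtains e where "e > 0" "\<And>y z. z \<in> F \<Longrightarrow> dist y z < e \<Longrightarrow> dist x y \<le> R + e \<Longrightarrow> y \<in> V"
proof (rule ccontr)
  assume neg: "\<not> thesis"
  define \<delta> where "\<delta> n = inverse (real (Suc n))" for n
  have \<delta>: "\<delta> \<longlonglongrightarrow> 0"
    unfolding \<delta>_def by (rule LIMSEQ_inverse_real_of_nat)
  have "\<exists>y z. z \<in> F \<and> dist y z < \<delta> n \<and> dist x y \<le> R + \<delta> n \<and> y \<notin> V" for n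
    using neg that[of "\<delta> n"] by (auto simp: \<delta>_def)
  then obtain y z where yz: "\<And>n. z n \<in> F" "\<And>n. dist (y n) (z n) < \<delta> n"
    "\<And>n. dist x (y n) \<le> R + \<delta> n" "\<And>n. y n \<notin> V"
    by metis
  obtain l s where l: "l \<in> F" and s: "strict_mono s" and zl: "(z \<circ> s) \<longlonglongrightarrow> l"
    using seq_compactE[OF compact_imp_seq_compact[OF assms(1)]] yz(1) by metis
  have \<delta>s: "(\<lambda>n. \<delta> (s n)) \<longlonglongrightarrow> 0"
    using LIMSEQ_subseq_LIMSEQ[OF \<delta> s] by (simp add: o_def)
  have "(\<lambda>n. dist (y (s n)) (z (s n))) \<longlonglongrightarrow> 0"
    by (rule tendsto_sandwich[OF _ _ tendsto_const \<delta>s])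
      (use yz(2) in \<open>auto intro!: always_eventually less_imp_le\<close>)
  moreover have "(\<lambda>n. dist (z (s n)) l) \<longlonglongrightarrow> 0"
    using zl tendsto_dist_iff[of "z \<circ> s" l] by (simp only: o_def)
  ultimately have sum0: "(\<lambda>n. dist (y (s n)) (z (s n)) + dist (z (s n)) l) \<longlonglongrightarrow> 0"
    using tendsto_add[of _ 0 _ _ 0] by simp
  have "(\<lambda>n. dist (y (s n)) l) \<longlonglongrightarrow> 0"
    by (rule tendsto_sandwich[OF _ _ tendsto_const sum0])
      (auto intro!: always_eventually dist_triangle)
  then have yl: "(\<lambda>n. y (s n)) \<longlonglongrightarrow> l"
    by (rule tendsto_dist_iff[THEN iffD2])
  have "dist x l \<le> R + 0"
    by (rule LIMSEQ_le[OF tendsto_dist[OF tendsto_const yl] tendsto_add[OF tendsto_const \<delta>s]])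
      (use yz(3) in auto)
  then have "l \<in> V"
    using l assms(3) by auto
  moreover have "l \<in> - V"
    using assms(2) yz(4) by (intro Lim_in_closed_set[OF _ _ _ yl]) (auto intro!: always_eventually)
  ultimately show False by simp
qed

lemma closed_uniformly_thick:
  "closed {F :: 'a::metric_space compacts. uniformly_thick \<alpha> C \<rho> (carrier_of F)}"
    (is "closed ?A")
  unfolding closed_def open_dist
proof
  fix F assume "F \<in> - ?A"
  then obtain r R x \<U> where r: "0 < r" "r < R" "R \<le> \<rho>" and x: "x \<in> carrier_of F"
    and cover: "open_cover_of_mesh r (cball x R \<inter> carrier_of F) \<U>"
    and few: "real (card \<U>) < C * (R / r) powr \<alpha>"
    unfolding uniformly_thick_def by (auto simp: not_le)
  have "open (\<Union>\<U>)" "cball x R \<inter> carrier_of F \<subseteq> \<Union>\<U>"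
    using cover unfolding open_cover_of_mesh_def by auto
  then obtain e where e: "e > 0" "\<And>y z. z \<in> carrier_of F \<Longrightarrow> dist y z < e \<Longrightarrow>
      dist x y \<le> R + e \<Longrightarrow> y \<in> \<Union>\<U>"
    using compact_ball_section_thickening[OF compact_carrier_of] by metis
  have "G \<in> - ?A" if G: "dist G F < e" for G
  proof -
    obtain x' where x': "x' \<in> carrier_of G" "dist x x' < e"
      using dist_compacts_less_imp_near[of F G e x] G x by (metis dist_commute)
    have "cball x' R \<inter> carrier_of G \<subseteq> \<Union>\<U>"
    proof
      fix y assume y: "y \<in> cball x' R \<inter> carrier_of G"
      then obtain z where "z \<in> carrier_of F" "dist y z < e"
        using dist_compacts_less_imp_near[OF G, of y] by auto
      moreover have "dist x y \<le> R + e"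
        using y x'(2) dist_triangle[of x y x'] by auto
      ultimately show "y \<in> \<Union>\<U>" by (rule e(2))
    qed
    then have "open_cover_of_mesh r (cball x' R \<inter> carrier_of G) \<U>"
      using cover unfolding open_cover_of_mesh_def by blast
    then have "\<not> uniformly_thick \<alpha> C \<rho> (carrier_of G)"
      using few r x'(1) unfolding uniformly_thick_def by (meson not_le)
    then show ?thesis by simp
  qed
  then show "\<exists>e>0. \<forall>G. dist G F < e \<longrightarrow> G \<in> - ?A" using e(1) by blast
qed

section \<open>The lower dimension as a countable supremum\<close>

text \<open>The absolute value confines the countable family of exponents to the non-negative rationals,
  and the same small number serves both as constant and as threshold.\<close>

definition thickness_step :: "rat \<times> nat \<Rightarrow> 'a::metric_space compacts \<Rightarrow> real" where
  "thickness_step = (\<lambda>(q, k) F.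
     if uniformly_thick \<bar>of_rat q\<bar> (1 / real (Suc k)) (1 / real (Suc k)) (carrier_of F)
     then \<bar>of_rat q\<bar> else 0)"

lemma baire_class_1_thickness_step: "baire_class 1 (thickness_step p)"
proof (cases p)
  case (Pair q k)
  show ?thesis
    using baire_class_1_step_closed[OF closed_uniformly_thick, of _ _ _ "\<bar>of_rat q\<bar>"]
    unfolding Pair thickness_step_def mem_Collect_eq prod.case .
qed

lemma thickness_step_nonneg: "0 \<le> thickness_step p F"
  by (cases p) (simp add: thickness_step_def)

text \<open>Given an admissible \<open>\<alpha>\<close> and any \<open>\<beta>\<close> with \<open>0 \<le> \<beta> < \<alpha>\<close>, monotonicity in the three parameters
  allows a rational exponent above \<open>\<beta>\<close> together with the reciprocal of a large integer.  Replacing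
  failure by the value \<open>0\<close> is harmless because the lower dimension is non-negative.\<close>

lemma Delta_L_eq_SUP_step: "Delta_L F = (SUP p. ereal (thickness_step p F))"
proof (rule antisym)
  let ?E = "carrier_of F"
  have ge_0: "0 \<le> (SUP p. ereal (thickness_step p F))"
    by (rule SUP_upper2[OF UNIV_I]) (simp add: thickness_step_nonneg)
  have "ereal \<alpha> \<le> (SUP p. ereal (thickness_step p F))"
    if thick: "uniformly_thick \<alpha> C \<rho> ?E" and pos: "C > 0" "\<rho> > 0" for \<alpha> C \<rho>
  proof (rule dense_le)
    fix y assume "y < ereal \<alpha>"
    show "y \<le> (SUP p. ereal (thickness_step p F))"
    proof (cases "y < 0")
      case True
      then show ?thesis using ge_0 by auto
    next
      case False
      then obtain \<beta> where \<beta>: "y = ereal \<beta>" "0 \<le> \<beta>" "\<beta> < \<alpha>"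
        using \<open>y < ereal \<alpha>\<close> by (cases y) auto
      then obtain q where q: "\<beta> < of_rat q" "of_rat q < \<alpha>"
        using of_rat_dense by blast
      obtain k where k: "1 / real (Suc k) < min C \<rho>"
        using nat_approx_posE[of "min C \<rho>"] pos by auto
      have "uniformly_thick \<bar>of_rat q\<bar> (1 / real (Suc k)) (1 / real (Suc k)) ?E"
        by (rule uniformly_thick_mono[OF thick]) (use q k \<beta>(2) pos in linarith)+
      then have "thickness_step (q, k) F = \<bar>of_rat q\<bar>"
        by (simp only: thickness_step_def prod.case if_True)
      then have "\<beta> \<le> thickness_step (q, k) F"
        using q by linarith
      then show ?thesis
        unfolding \<beta>(1) by (intro SUP_upper2[of "(q, k)"]) auto
    qed
  qed
  then show "Delta_L F \<le> (SUP p. ereal (thickness_step p F))"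
    unfolding Delta_L_def lower_dim_eq_Sup_uniformly_thick by (auto intro!: Sup_least)
  have upper: "ereal \<alpha> \<le> Delta_L F" if "uniformly_thick \<alpha> C \<rho> ?E" "C > 0" "\<rho> > 0" for \<alpha> C \<rho>
    unfolding Delta_L_def lower_dim_eq_Sup_uniformly_thick using that by (intro Sup_upper) auto
  show "(SUP p. ereal (thickness_step p F)) \<le> Delta_L F"
  proof (rule SUP_least)
    fix p :: "rat \<times> nat"
    obtain q k where p: "p = (q, k)" by (cases p)
    show "ereal (thickness_step p F) \<le> Delta_L F"
      using upper[of "\<bar>of_rat q\<bar>" "1 / real (Suc k)" "1 / real (Suc k)"]
        upper[OF uniformly_thick_0[of 1]]
      by (auto simp: p thickness_step_def)
  qed
qed

definition thickness_max :: "nat \<Rightarrow> 'a::metric_space compacts \<Rightarrow> real" where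
  "thickness_max m F = Max ((\<lambda>i. thickness_step (from_nat i) F) ` {..m})"

lemma baire_class_1_thickness_max: "baire_class 1 (thickness_max m)"
  unfolding thickness_max_def by (intro baire_class_Max baire_class_1_thickness_step)

lemma thickness_max_tendsto_Delta_L: "(\<lambda>m. ereal (thickness_max m F)) \<longlonglongrightarrow> Delta_L F"
proof -
  have "ereal (thickness_max m F) = Max ((\<lambda>i. ereal (thickness_step (from_nat i) F)) ` {..m})" for m
    unfolding thickness_max_def
    by (subst mono_Max_commute) (auto simp: mono_def image_image)
  moreover have "Delta_L F = (SUP i. ereal (thickness_step (from_nat i) F))"
    unfolding Delta_L_eq_SUP_step
    using image_image[of "\<lambda>p. ereal (thickness_step p F)" from_nat UNIV] by simp
  ultimately show ?thesis
    using Max_prefix_tendsto_SUP[of "\<lambda>i. ereal (thickness_step (from_nat i) F)"] by simp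
qed

lemma baire_class_2_Delta_L: "baire_class 2 Delta_L"
proof -
  have "baire_class 1 (\<lambda>F. ereal (thickness_max m F))" for m
    by (intro baire_class_continuous_compose[OF _ baire_class_1_thickness_max] continuous_on_ereal
        continuous_on_id)
  from baire_class_SucI[of 1, OF this thickness_max_tendsto_Delta_L]
  show ?thesis by (simp only: Suc_1)
qed

lemma baire_class_2_real_Delta_L:
  assumes "\<And>F :: 'a::metric_space compacts. Delta_L F \<noteq> \<infinity>"
  shows "baire_class 2 (\<lambda>F :: 'a compacts. real_of_ereal (Delta_L F))"
proof -
  have "(\<lambda>m. thickness_max m F) \<longlonglongrightarrow> real_of_ereal (Delta_L F)" for F :: "'a compacts"
  proof -
    have "0 \<le> Delta_L F"
      unfolding Delta_L_eq_SUP_step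
      by (rule SUP_upper2[OF UNIV_I]) (simp add: thickness_step_nonneg)
    then have "ereal (real_of_ereal (Delta_L F)) = Delta_L F"
      using assms[of F] by (cases "Delta_L F") auto
    then show ?thesis
      using thickness_max_tendsto_Delta_L[of F] by (metis lim_ereal)
  qed
  from baire_class_SucI[of 1, OF baire_class_1_thickness_max this]
  show ?thesis by (simp only: Suc_1)
qed

theorem theorem2p7:
  assumes "compact (UNIV :: 'a::metric_space set)"
  shows "baire_class 3 (Delta_L :: 'a compacts \<Rightarrow> ereal) \<and>
         (Delta_L :: 'a compacts \<Rightarrow> ereal) \<in> borel_measurable borel \<and>
         ((\<forall>F :: 'a compacts. Delta_L F \<noteq> \<infinity>) \<longrightarrow>
            baire_class 3 (\<lambda>F :: 'a compacts. real_of_ereal (Delta_L F)) \<and>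
            (\<lambda>F :: 'a compacts. real_of_ereal (Delta_L F)) \<in> borel_measurable borel)"
proof (intro conjI impI)
  have three: "Suc 2 = 3" by simp
  show "baire_class 3 (Delta_L :: 'a compacts \<Rightarrow> ereal)"
    using baire_class_Suc_mono[OF baire_class_2_Delta_L] unfolding three .
  show meas: "(Delta_L :: 'a compacts \<Rightarrow> ereal) \<in> borel_measurable borel"
    by (rule baire_class_imp_borel_measurable[OF baire_class_2_Delta_L])
  assume fin: "\<forall>F :: 'a compacts. Delta_L F \<noteq> \<infinity>"
  show "baire_class 3 (\<lambda>F :: 'a compacts. real_of_ereal (Delta_L F))"
    using baire_class_Suc_mono[OF baire_class_2_real_Delta_L] fin unfolding three by blast
  show "(\<lambda>F :: 'a compacts. real_of_ereal (Delta_L F)) \<in> borel_measurable borel"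
    using meas by (rule borel_measurable_real_of_ereal)
qed

end
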